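(* Let $2\le k\le n-2$. Let $[M]\in\overline{X}(k,n)$ be a fixed point of the cyclic action on $\overline{X}(k,n)$, and suppose that none of the $2n$ minors $p_{i,i+1,\ldots,i+k-2,i+k-1}(M)$ and $p_{i,i+1,\ldots,i+k-2,i+k}(M)$, $i=1,\ldots,n$ (indices modulo $n$), vanishes. Then $[M]$ is a critical point of the planar kinematics potential $$\mathcal{S}^{(PK)}_{k,n}=\sum_{i=1}^n\log\left(\frac{p_{i,i+1,\ldots,i+(k-2),i+(k-1)}}{p_{i,i+1,\ldots,i+(k-2),i+k}}\right).$$
   Context: Column indices are taken modulo $n$. For a complex $k\times n$ matrix $M$, $p_{i_1,\ldots,i_k}(M)$ is the determinant of the $k\times k$ matrix formed by columns $i_1,\ldots,i_k$ of $M$ in this order. $\overline{X}(k,n)$ is the set of complex $k\times n$ matrices of rank $k$ with no zero column, modulo left multiplication by $SL(k)$ and right multiplication by the torus $(\mathbb{C}^* )^n$ of invertible diagonal $n\times n$ matrices (rescaling of columns). Since the torus contains the scalars, this is the same as the quotient by $GL(k)\times(\mathbb{C}^* )^n$. Points represent configurations of $n$ labeled points in $\mathbb{CP}^{k-1}$. The class of $M$ is denoted $[M]$. The cyclic action is generated by the cyclic shift of columns, $[(v_1,\ldots,v_n)]\mapsto[(v_2,\ldots,v_n,v_1)]$; a fixed point is a class $[M]$ preserved by it, i.e. the shifted matrix equals $A M D$ for some $A\in GL(k)$ and some invertible diagonal $D$. The function $\mathcal{S}^{(PK)}_{k,n}$ is multivalued because of the logarithm, but its differential is well defined wherever all minors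 appearing in it are nonzero, and it is invariant (up to constants) under left multiplication by $GL(k)$ and under rescaling of columns. A class $[M]$ at which all these minors are nonzero is a critical point if all partial derivatives of $\mathcal{S}^{(PK)}_{k,n}$ with respect to the matrix entries vanish at $M$. *)

theory Defs
  imports "HOL-Analysis.Complex_Transcendental" "Jordan_Normal_Form.DL_Rank"
begin

text \<open>
  Columns are numbered from 0, and every column index is read modulo the number of columns.
\<close>

definition pluecker :: "complex mat \<Rightarrow> nat list \<Rightarrow> complex" where
  "pluecker M js =
     Determinant.det (mat_of_cols (dim_row M) (map (\<lambda>j. col M (j mod dim_col M)) js))"

text \<open>\<open>p\<^bsub>i,i+1,\<dots>,i+k-2,i+k-1\<^esub>\<close> and \<open>p\<^bsub>i,i+1,\<dots>,i+k-2,i+k\<^esub>\<close>:\<close>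

definition minor_num :: "nat \<Rightarrow> nat \<Rightarrow> complex mat \<Rightarrow> complex" where
  "minor_num k i M = pluecker M [i..<i + k]"

definition minor_den :: "nat \<Rightarrow> nat \<Rightarrow> complex mat \<Rightarrow> complex" where
  "minor_den k i M = pluecker M ([i..<i + k - 1] @ [i + k])"


definition config_mats :: "nat \<Rightarrow> nat \<Rightarrow> complex mat set" where
  "config_mats k n =
     {M \<in> carrier_mat k n. vec_space.rank k M = k \<and> (\<forall>j<n. col M j \<noteq> 0\<^sub>v k)}"

definition config_rel :: "nat \<Rightarrow> nat \<Rightarrow> (complex mat \<times> complex mat) set" where
  "config_rel k n =
     {(M, N). M \<in> config_mats k n \<and> N \<in> config_mats k n \<and>
        (\<exists>A D. A \<in> carrier_mat k k \<and> Determinant.det A = 1 \<and>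
               D \<in> carrier_mat n n \<and> diagonal_mat D \<and> invertible_mat D \<and>
               N = A * M * D)}"

definition config_space :: "nat \<Rightarrow> nat \<Rightarrow> complex mat set set" where
  "config_space k n = config_mats k n // config_rel k n"

definition config_class :: "nat \<Rightarrow> nat \<Rightarrow> complex mat \<Rightarrow> complex mat set" where
  "config_class k n M = config_rel k n `` {M}"


definition cyclic_shift :: "complex mat \<Rightarrow> complex mat" where
  "cyclic_shift M =
     mat (dim_row M) (dim_col M) (\<lambda>(a, j). M $$ (a, Suc j mod dim_col M))"

text \<open>
  The shift sends \<open>A * M * D\<close> to \<open>A * cyclic_shift M * D'\<close>, where \<open>D'\<close> is \<open>D\<close> with its diagonal
  entries shifted cyclically, so the image of the class of \<open>M\<close> is the class of \<open>cyclic_shift M\<close>.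
\<close>

definition cyclic_fixed_point :: "nat \<Rightarrow> nat \<Rightarrow> complex mat set \<Rightarrow> bool" where
  "cyclic_fixed_point k n C \<longleftrightarrow> C \<in> config_space k n \<and> cyclic_shift ` C = C"


text \<open>
  The logarithms in the potential are multivalued. A single-valued determination of the potential
  near \<open>M\<close> is obtained by choosing, for each summand, a continuous logarithm \<open>l i\<close> on a
  neighbourhood of the value at \<open>M\<close> of its argument. Such a choice exists whenever this value is
  nonzero (lemma \<open>log_branch_at_exists\<close>), and two choices differ locally by a constant.
\<close>

definition log_branch_at :: "complex \<Rightarrow> (complex \<Rightarrow> complex) \<Rightarrow> bool" where
  "log_branch_at w l \<longleftrightarrow>
     (\<exists>U. open U \<and> w \<in> U \<and> continuous_on U l \<and> (\<forall>z\<in>U. exp (l z) = z))"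

lemma log_branch_at_exists:
  assumes "w \<noteq> 0"
  shows "\<exists>l. log_branch_at w l"
proof -
  let ?U = "(\<lambda>z. z / w) -` (- \<real>\<^sub>\<le>\<^sub>0)"
  let ?l = "\<lambda>z. Ln (z / w) + Ln w"
  have "open ?U"
    using assms by (intro continuous_open_vimage) (auto intro!: continuous_intros)
  moreover have "w \<in> ?U"
    using assms by simp
  moreover have "continuous_on ?U ?l"
    using assms by (intro continuous_intros) auto
  moreover have "\<forall>z\<in>?U. exp (?l z) = z"
  proof
    fix z assume "z \<in> ?U"
    then have "z / w \<noteq> 0"
      by auto
    then show "exp (?l z) = z"
      using assms by (simp only: exp_add exp_Ln) simp
  qed
  ultimately show ?thesis
    unfolding log_branch_at_def by blast
qed

definition PK_potential ::
    "nat \<Rightarrow> nat \<Rightarrow> (nat \<Rightarrow> complex \<Rightarrow> complex) \<Rightarrow> complex mat \<Rightarrow> complex" where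
  "PK_potential k n l M = (\<Sum>i<n. l i (minor_num k i M / minor_den k i M))"

definition PK_minors_nonzero :: "nat \<Rightarrow> nat \<Rightarrow> complex mat \<Rightarrow> bool" where
  "PK_minors_nonzero k n M \<longleftrightarrow> (\<forall>i<n. minor_num k i M \<noteq> 0 \<and> minor_den k i M \<noteq> 0)"

definition PK_partials_vanish :: "nat \<Rightarrow> nat \<Rightarrow> complex mat \<Rightarrow> bool" where
  "PK_partials_vanish k n M \<longleftrightarrow>
     (\<forall>l. (\<forall>i<n. log_branch_at (minor_num k i M / minor_den k i M) (l i)) \<longrightarrow>
        (\<forall>a<k. \<forall>b<n.
           ((\<lambda>z. PK_potential k n l (update_mat M (a, b) z)) has_field_derivative 0)
             (at (M $$ (a, b)))))"

definition PK_critical_point :: "nat \<Rightarrow> nat \<Rightarrow> complex mat set \<Rightarrow> bool" where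
  "PK_critical_point k n C \<longleftrightarrow>
     C \<in> config_space k n \<and> (\<forall>M\<in>C. PK_minors_nonzero k n M \<and> PK_partials_vanish k n M)"

end

theory Submission
  imports Defs
begin

text \<open>
  Write \<open>v j\<close> for the columns of a representative \<open>M\<close>, with \<open>j\<close> read modulo \<open>n\<close>, and \<open>L b w\<close> for the
  derivative of the potential at \<open>M\<close> when column \<open>b\<close> moves in the direction \<open>w\<close>. It is linear in
  \<open>w\<close>, and the claim is that every \<open>L b\<close> is zero. That the class of \<open>M\<close> is fixed by the cyclic shift
  says \<open>v (j + 1) = d j * A v j\<close> for an invertible matrix \<open>A\<close> and nonzero scalars \<open>d j\<close>.

  Two symmetries suffice. First, the potential is a sum over all cyclic windows, so shifting the
  columns only permutes its summands, while applying \<open>A\<close> and rescaling columns multiplies each minor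
  by a constant, which a logarithmic derivative does not see. Hence
  \<open>L (b + 1) (d b * A w) = L b w\<close> (lemma \<open>PK_dlog_shift\<close>). As \<open>A\<close> commutes with its powers, it follows
  that \<open>L b (A^j v b)\<close> does not depend on \<open>b\<close>. Secondly, the sum of \<open>L b (X v b)\<close> over all \<open>b\<close> is the
  derivative of the potential along \<open>X M\<close>, for any square matrix \<open>X\<close>; this is zero, since each minor
  contributes the trace of \<open>X\<close>, and as many minors occur in numerators as in denominators (lemma
  \<open>sum_PK_dlog_image\<close>). With \<open>X = A^j\<close> this gives \<open>n\<close> equal numbers whose sum is zero, so
  \<open>L b (A^j v b) = 0\<close>.

  But \<open>A^j v b\<close> is proportional to \<open>v (b + j)\<close>, so \<open>L b\<close> vanishes on \<open>v b, \<dots>, v (b + k - 1)\<close>. These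
  vectors form a basis because the corresponding consecutive minor is nonzero, and therefore
  \<open>L b = 0\<close>.
\<close>

unbundle no vec_syntax

definition cyc_col :: "complex mat \<Rightarrow> nat \<Rightarrow> complex vec" where
  "cyc_col M j = col M (j mod dim_col M)"

lemma dim_cyc_col [simp]: "dim_vec (cyc_col M j) = dim_row M"
  by (simp add: cyc_col_def)

lemma cyc_col_carrier: "M \<in> carrier_mat k n \<Longrightarrow> cyc_col M j \<in> carrier_vec k"
  by (simp add: carrier_vecI)

lemma pluecker_cyc_col:
  "pluecker M js = Determinant.det (mat_of_cols (dim_row M) (map (cyc_col M) js))"
  by (simp add: pluecker_def cyc_col_def[abs_def])

section \<open>Determinants with one column replaced\<close>

lemma det_replace_column:
  fixes vs :: "complex vec list"
  assumes "length vs = k" and "r < k" and "w \<in> carrier_vec k"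
  shows "Determinant.det (mat_of_cols k (vs[r := w]))
    = (\<Sum>a<k. w $ a * cofactor (mat_of_cols k vs) a r)"
proof -
  let ?B = "mat_of_cols k (vs[r := w])"
  have B: "?B \<in> carrier_mat k k"
    using assms(1) by (metis length_list_update mat_of_cols_carrier(1))
  have "Determinant.det ?B = (\<Sum>a<k. ?B $$ (a, r) * cofactor ?B a r)"
    by (rule laplace_expansion_column[OF B assms(2)])
  also have "\<dots> = (\<Sum>a<k. w $ a * cofactor (mat_of_cols k vs) a r)"
  proof (rule sum.cong[OF refl])
    fix a assume "a \<in> {..<k}"
    then have a: "a < k" by simp
    have "?B $$ (a, r) = w $ a"
      using a assms by (simp add: mat_of_cols_index)
    moreover have "mat_delete ?B a r = mat_delete (mat_of_cols k vs) a r"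
      using a assms by (intro eq_matI) (auto simp: mat_delete_def mat_of_cols_index)
    ultimately show "?B $$ (a, r) * cofactor ?B a r = w $ a * cofactor (mat_of_cols k vs) a r"
      by (simp add: cofactor_def)
  qed
  finally show ?thesis .
qed

text \<open>
  This is the derivative of \<open>det (exp (t X) V) = exp (t tr X) det V\<close> at \<open>t = 0\<close>. Algebraically, the
  left-hand side is the trace of \<open>X V adj V\<close>, so it holds for singular \<open>V\<close> as well.
\<close>

lemma sum_det_replace_column_image:
  fixes vs :: "complex vec list"
  assumes len: "length vs = k" and vs: "\<And>r. r < k \<Longrightarrow> vs ! r \<in> carrier_vec k"
    and X: "X \<in> carrier_mat k k"
  shows "(\<Sum>r<k. Determinant.det (mat_of_cols k (vs[r := X *\<^sub>v (vs ! r)])))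
    = (\<Sum>a<k. X $$ (a, a)) * Determinant.det (mat_of_cols k vs)"
proof -
  let ?V = "mat_of_cols k vs"
  have V: "?V \<in> carrier_mat k k"
    using len by (metis mat_of_cols_carrier(1))
  have adj: "(\<Sum>r<k. ?V $$ (c, r) * cofactor ?V a r) = (if a = c then Determinant.det ?V else 0)"
    if "a < k" "c < k" for a c
  proof -
    have "(\<Sum>r<k. ?V $$ (c, r) * cofactor ?V a r) = (?V * adj_mat ?V) $$ (c, a)"
      using that V len
      by (auto simp: adj_mat_def scalar_prod_def lessThan_atLeast0 intro!: sum.cong)
    also have "\<dots> = (if a = c then Determinant.det ?V else 0)"
      using that by (simp add: adj_mat(2)[OF V])
    finally show ?thesis .
  qed
  have "(\<Sum>r<k. Determinant.det (mat_of_cols k (vs[r := X *\<^sub>v (vs ! r)])))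
    = (\<Sum>r<k. \<Sum>a<k. (X *\<^sub>v (vs ! r)) $ a * cofactor ?V a r)"
    using X vs by (intro sum.cong refl det_replace_column len) auto
  also have "\<dots> = (\<Sum>r<k. \<Sum>a<k. \<Sum>c<k. X $$ (a, c) * (?V $$ (c, r) * cofactor ?V a r))"
  proof (intro sum.cong refl)
    fix r a assume "r \<in> {..<k}" "a \<in> {..<k}"
    then have ra: "r < k" "a < k" by auto
    have "(X *\<^sub>v (vs ! r)) $ a = (\<Sum>c<k. X $$ (a, c) * ?V $$ (c, r))"
      using ra X vs[OF ra(1)] len
      by (auto simp: scalar_prod_def lessThan_atLeast0 mat_of_cols_index intro!: sum.cong)
    then show "(X *\<^sub>v (vs ! r)) $ a * cofactor ?V a r
      = (\<Sum>c<k. X $$ (a, c) * (?V $$ (c, r) * cofactor ?V a r))"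
      by (simp add: sum_distrib_right mult.assoc)
  qed
  also have "\<dots> = (\<Sum>a<k. \<Sum>r<k. \<Sum>c<k. X $$ (a, c) * (?V $$ (c, r) * cofactor ?V a r))"
    by (rule sum.swap)
  also have "\<dots> = (\<Sum>a<k. \<Sum>c<k. \<Sum>r<k. X $$ (a, c) * (?V $$ (c, r) * cofactor ?V a r))"
    by (intro sum.cong refl sum.swap)
  also have "\<dots> = (\<Sum>a<k. \<Sum>c<k. X $$ (a, c) * (if a = c then Determinant.det ?V else 0))"
    by (intro sum.cong refl) (simp add: sum_distrib_left[symmetric] adj)
  also have "\<dots> = (\<Sum>a<k. X $$ (a, a) * Determinant.det ?V)"
    by (intro sum.cong refl) (simp add: if_distrib[of "\<lambda>t. _ * t"] cong: if_cong)
  finally show ?thesis by (simp add: sum_distrib_right)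
qed

lemma det_scaled_image_columns:
  fixes vs us :: "complex vec list"
  assumes lens: "length vs = k" "length us = k"
    and vs: "\<And>r. r < k \<Longrightarrow> vs ! r \<in> carrier_vec k" and A: "A \<in> carrier_mat k k"
    and us: "\<And>r. r < k \<Longrightarrow> us ! r = d r \<cdot>\<^sub>v (A *\<^sub>v (vs ! r))"
  shows "Determinant.det (mat_of_cols k us)
    = Determinant.det A * (\<Prod>r<k. d r) * Determinant.det (mat_of_cols k vs)"
proof -
  let ?V = "mat_of_cols k vs" and ?D = "mat_diag k d"
  have V: "?V \<in> carrier_mat k k"
    using lens by (metis mat_of_cols_carrier(1))
  have "mat_of_cols k us = A * ?V * ?D"
    using A V lens us vs
    by (subst mat_diag_mult_right[of _ k])
       (auto intro!: eq_matI simp: mat_of_cols_index)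
  moreover have "Determinant.det ?D = (\<Prod>r<k. d r)"
  proof -
    have "Determinant.det ?D = prod_list (diag_mat ?D)"
      by (rule det_upper_triangular[of _ k]) (auto simp: mat_diag_def)
    also have "\<dots> = (\<Prod>r<k. d r)"
      by (auto simp: prod_list_diag_prod mat_diag_def lessThan_atLeast0 intro!: prod.cong)
    finally show ?thesis .
  qed
  ultimately show ?thesis
    using A V by (simp add: det_mult[of _ k])
qed

section \<open>Logarithmic derivatives of minors\<close>

text \<open>
  The derivative of a minor when column \<open>b\<close> of the matrix moves in the direction \<open>w\<close>. A minor may
  list the same column at several positions, whence the sum; comparing \<open>b\<close> modulo the number of
  columns as well lets \<open>b\<close> be shifted without wrapping around.
\<close>

definition pluecker_dir ::
    "complex mat \<Rightarrow> nat list \<Rightarrow> nat \<Rightarrow> complex vec \<Rightarrow> complex" where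
  "pluecker_dir M js b w =
     (\<Sum>r<length js. if js ! r mod dim_col M = b mod dim_col M
        then Determinant.det (mat_of_cols (dim_row M) ((map (cyc_col M) js)[r := w])) else 0)"

lemma pluecker_dir_linear:
  assumes "dim_row M = k" and "length js = k" and w: "w \<in> carrier_vec k"
  shows "pluecker_dir M js b w = (\<Sum>a<k. w $ a * pluecker_dir M js b (unit_vec k a))"
proof -
  let ?C = "cofactor (mat_of_cols k (map (cyc_col M) js))"
  have dir: "pluecker_dir M js b u = (\<Sum>a<k. u $ a *
      (\<Sum>r<k. if js ! r mod dim_col M = b mod dim_col M then ?C a r else 0))"
    if "u \<in> carrier_vec k" for u
  proof -
    have "pluecker_dir M js b u = (\<Sum>r<k. \<Sum>a<k. u $ a *
      (if js ! r mod dim_col M = b mod dim_col M then ?C a r else 0))"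
      using assms(1,2) that unfolding pluecker_dir_def
      by (intro sum.cong) (auto simp: det_replace_column)
    then show ?thesis
      by (subst (asm) sum.swap) (simp add: sum_distrib_left)
  qed
  have "pluecker_dir M js b (unit_vec k a) =
      (\<Sum>r<k. if js ! r mod dim_col M = b mod dim_col M then ?C a r else 0)" if "a < k" for a
    using that by (simp add: dir if_distrib[of "\<lambda>t. t * _"] cong: if_cong)
  then show ?thesis by (simp add: dir[OF w])
qed

text \<open>
  A minor whose column indices are distinct modulo \<open>n\<close> is an affine function of a single entry of the matrix, and
  its slope is a cofactor.
\<close>

lemma pluecker_has_field_derivative:
  assumes M: "M \<in> carrier_mat k n" and ab: "a < k" "b < n" and len: "length js = k"
    and dist: "distinct (map (\<lambda>j. j mod n) js)"
  shows "((\<lambda>z. pluecker (update_mat M (a, b) z) js) has_field_derivative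
    pluecker_dir M js b (unit_vec k a)) (at (M $$ (a, b)))"
proof (cases "\<exists>r<k. js ! r mod n = b")
  case True
  then obtain r where r: "r < k" "js ! r mod n = b" by blast
  have uniq: "js ! s mod n = b \<longleftrightarrow> s = r" if "s < k" for s
    using that r len nth_eq_iff_index_eq[OF dist, of s r] by simp
  let ?vs = "map (cyc_col M) js"
  let ?C = "cofactor (mat_of_cols k ?vs)"
  have dir: "pluecker_dir M js b (unit_vec k a) = ?C a r"
  proof -
    have "pluecker_dir M js b (unit_vec k a) = (\<Sum>s<k. if s = r
        then Determinant.det (mat_of_cols k (?vs[s := unit_vec k a])) else 0)"
      using uniq ab M len unfolding pluecker_dir_def
      by (intro sum.cong) auto
    also have "\<dots> = (\<Sum>c<k. unit_vec k a $ c * ?C c r)"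
      using r len by (simp add: det_replace_column)
    also have "\<dots> = ?C a r"
      using ab by (simp add: if_distrib[of "\<lambda>t. t * _"] cong: if_cong)
    finally show ?thesis .
  qed
  have "pluecker (update_mat M (a, b) z) js =
      (\<Sum>c<k. (if c = a then z else M $$ (c, b)) * ?C c r)" for z
  proof -
    let ?w = "Matrix.vec k (\<lambda>c. if c = a then z else M $$ (c, b))"
    have "map (cyc_col (update_mat M (a, b) z)) js = ?vs[r := ?w]"
    proof (rule nth_equalityI)
      fix s assume s: "s < length (map (cyc_col (update_mat M (a, b) z)) js)"
      have lt: "js ! s mod n < n" using ab by simp
      show "map (cyc_col (update_mat M (a, b) z)) js ! s = ?vs[r := ?w] ! s"
        using s len M r uniq[of s] ab lt
        by (cases "s = r") (auto intro!: eq_vecI simp: update_mat_def cyc_col_def)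
    qed simp
    then show ?thesis
      using r len M by (simp add: pluecker_cyc_col det_replace_column)
  qed
  then have "(\<lambda>z. pluecker (update_mat M (a, b) z) js) =
      (\<lambda>z. \<Sum>c<k. (if c = a then z else M $$ (c, b)) * ?C c r)" by blast
  also have "\<dots> = (\<lambda>z. (\<Sum>c\<in>{..<k}-{a}. M $$ (c, b) * ?C c r) + z * ?C a r)"
  proof
    fix z
    show "(\<Sum>c<k. (if c = a then z else M $$ (c, b)) * ?C c r)
      = (\<Sum>c\<in>{..<k}-{a}. M $$ (c, b) * ?C c r) + z * ?C a r"
      using ab by (subst sum.remove[of _ a]) auto
  qed
  finally show ?thesis
    unfolding dir by (auto intro!: derivative_eq_intros)
next
  case False
  have "pluecker_dir M js b (unit_vec k a) = 0"
    using False ab M len by (auto simp: pluecker_dir_def intro!: sum.neutral)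
  moreover have "pluecker (update_mat M (a, b) z) js = pluecker M js" for z
  proof -
    have "map (cyc_col (update_mat M (a, b) z)) js = map (cyc_col M) js"
    proof (rule nth_equalityI)
      fix s assume s: "s < length (map (cyc_col (update_mat M (a, b) z)) js)"
      have lt: "js ! s mod n < n" using ab by simp
      show "map (cyc_col (update_mat M (a, b) z)) js ! s = map (cyc_col M) js ! s"
        using s len M False ab lt
        by (auto intro!: eq_vecI simp: update_mat_def cyc_col_def)
    qed simp
    then show ?thesis by (simp add: pluecker_cyc_col del: map_eq_conv)
  qed
  ultimately show ?thesis by simp
qed

lemma sum_pluecker_dir_image:
  assumes M: "M \<in> carrier_mat k n" and n: "0 < n" and len: "length js = k"
    and X: "X \<in> carrier_mat k k"
  shows "(\<Sum>b<n. pluecker_dir M js b (X *\<^sub>v cyc_col M b))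
    = (\<Sum>a<k. X $$ (a, a)) * pluecker M js"
proof -
  let ?vs = "map (cyc_col M) js"
  let ?f = "\<lambda>r w. Determinant.det (mat_of_cols k (?vs[r := w]))"
  have "(\<Sum>b<n. pluecker_dir M js b (X *\<^sub>v cyc_col M b))
    = (\<Sum>r<k. \<Sum>b<n. if js ! r mod n = b then ?f r (X *\<^sub>v cyc_col M b) else 0)"
    using M len unfolding pluecker_dir_def by (subst sum.swap) (simp cong: if_cong)
  also have "\<dots> = (\<Sum>r<k. ?f r (X *\<^sub>v (?vs ! r)))"
    using M len n by (intro sum.cong refl) (simp add: cyc_col_def)
  also have "\<dots> = (\<Sum>a<k. X $$ (a, a)) * Determinant.det (mat_of_cols k ?vs)"
    using len cyc_col_carrier[OF M] by (intro sum_det_replace_column_image X) auto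
  finally show ?thesis using M by (simp add: pluecker_cyc_col)
qed

definition dlog_pluecker ::
    "complex mat \<Rightarrow> nat list \<Rightarrow> nat \<Rightarrow> complex vec \<Rightarrow> complex" where
  "dlog_pluecker M js b w = pluecker_dir M js b w / pluecker M js"

text \<open>
  The derivative of the potential when column \<open>b\<close> moves in the direction \<open>w\<close>, written without a
  choice of logarithms.
\<close>

definition PK_dlog ::
    "nat \<Rightarrow> complex mat \<Rightarrow> nat \<Rightarrow> complex vec \<Rightarrow> complex" where
  "PK_dlog k M b w = (\<Sum>i<dim_col M. dlog_pluecker M [i..<i + k] b w
     - dlog_pluecker M ([i..<i + k - 1] @ [i + k]) b w)"

lemma PK_dlog_linear:
  assumes "dim_row M = k" and "0 < k" and w: "w \<in> carrier_vec k"
  shows "PK_dlog k M b w = (\<Sum>a<k. w $ a * PK_dlog k M b (unit_vec k a))"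
proof -
  have lin: "dlog_pluecker M js b w = (\<Sum>a<k. w $ a * dlog_pluecker M js b (unit_vec k a))"
    if "length js = k" for js
    using pluecker_dir_linear[OF assms(1) that w, of b]
    by (simp add: dlog_pluecker_def sum_divide_distrib)
  have "PK_dlog k M b w = (\<Sum>i<dim_col M. \<Sum>a<k. w $ a *
      (dlog_pluecker M [i..<i + k] b (unit_vec k a)
       - dlog_pluecker M ([i..<i + k - 1] @ [i + k]) b (unit_vec k a)))"
    unfolding PK_dlog_def using assms(2)
    by (intro sum.cong refl) (simp add: lin right_diff_distrib sum_subtractf)
  then show ?thesis
    by (subst (asm) sum.swap) (simp add: sum_distrib_left PK_dlog_def)
qed

lemma PK_dlog_smult:
  assumes "dim_row M = k" and "0 < k" and w: "w \<in> carrier_vec k"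
  shows "PK_dlog k M b (c \<cdot>\<^sub>v w) = c * PK_dlog k M b w"
proof -
  have "PK_dlog k M b (c \<cdot>\<^sub>v w) = (\<Sum>a<k. (c \<cdot>\<^sub>v w) $ a * PK_dlog k M b (unit_vec k a))"
    using w by (intro PK_dlog_linear assms(1,2)) simp
  also have "\<dots> = c * (\<Sum>a<k. w $ a * PK_dlog k M b (unit_vec k a))"
    using w by (simp add: sum_distrib_left mult.assoc)
  finally show ?thesis
    by (simp only: PK_dlog_linear[OF assms, symmetric])
qed

text \<open>
  Infinitesimal invariance of the potential under left multiplication: moving all columns at once
  along \<open>X\<close> changes the logarithm of every minor at the same rate, namely the trace of \<open>X\<close>, and the
  numerators cancel the denominators.
\<close>

lemma sum_PK_dlog_image:
  assumes M: "M \<in> carrier_mat k n" and k: "0 < k" and n: "0 < n"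
    and nz: "PK_minors_nonzero k n M" and X: "X \<in> carrier_mat k k"
  shows "(\<Sum>b<n. PK_dlog k M b (X *\<^sub>v cyc_col M b)) = 0"
proof -
  have tr: "(\<Sum>b<n. dlog_pluecker M js b (X *\<^sub>v cyc_col M b)) = (\<Sum>a<k. X $$ (a, a))"
    if "length js = k" "pluecker M js \<noteq> 0" for js
    using sum_pluecker_dir_image[OF M n that(1) X] that(2)
    by (simp add: dlog_pluecker_def sum_divide_distrib[symmetric])
  have "(\<Sum>b<n. PK_dlog k M b (X *\<^sub>v cyc_col M b)) = (\<Sum>i<n.
      (\<Sum>b<n. dlog_pluecker M [i..<i + k] b (X *\<^sub>v cyc_col M b))
      - (\<Sum>b<n. dlog_pluecker M ([i..<i + k - 1] @ [i + k]) b (X *\<^sub>v cyc_col M b)))"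
    unfolding PK_dlog_def using M by (subst sum.swap) (simp add: sum_subtractf)
  also have "\<dots> = 0"
    using nz k unfolding PK_minors_nonzero_def minor_num_def minor_den_def
    by (intro sum.neutral) (simp add: tr)
  finally show ?thesis .
qed

lemma log_branch_has_field_derivative:
  fixes l :: "complex \<Rightarrow> complex"
  assumes "log_branch_at w l" and "w \<noteq> 0"
  shows "(l has_field_derivative inverse w) (at w)"
proof -
  obtain U where U: "open U" "w \<in> U" "continuous_on U l" "\<And>z. z \<in> U \<Longrightarrow> exp (l z) = z"
    using assms(1) unfolding log_branch_at_def by blast
  have "(exp has_field_derivative w) (at (l w))"
    using DERIV_exp[of "l w"] U by simp
  moreover have "continuous (at w) l"
    using U continuous_on_eq_continuous_at by blast
  ultimately show ?thesis
    using assms(2) U by (intro has_field_derivative_inverse_basic[where f = exp and t = U]) auto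
qed

text \<open>
  A minor of the potential takes its columns from \<open>k + 1\<close> consecutive ones, so they are distinct
  modulo \<open>n\<close> as soon as \<open>k < n\<close>.
\<close>

lemma inj_on_mod_window:
  assumes "k < n"
  shows "inj_on (\<lambda>j::nat. j mod n) {i..i + k}"
proof (rule inj_onI)
  fix x y :: nat
  assume xy: "x \<in> {i..i + k}" "y \<in> {i..i + k}" "x mod n = y mod n"
  have le: "x = y" if "x \<le> y" "x mod n = y mod n" "y < x + n" for x y :: nat
  proof -
    have "n dvd y - x" using that by (metis mod_eq_dvd_iff_nat)
    then show ?thesis using that by (auto dest: dvd_imp_le)
  qed
  then show "x = y"
  proof (cases "x \<le> y")
    case True
    show ?thesis by (rule le) (use xy assms True in auto)
  next
    case False
    show ?thesis by (rule le[symmetric]) (use xy assms False in auto)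
  qed
qed

lemma PK_potential_has_field_derivative:
  assumes M: "M \<in> carrier_mat k n" and k: "0 < k" "k < n" and ab: "a < k" "b < n"
    and nz: "PK_minors_nonzero k n M"
    and l: "\<And>i. i < n \<Longrightarrow> log_branch_at (minor_num k i M / minor_den k i M) (l i)"
  shows "((\<lambda>z. PK_potential k n l (update_mat M (a, b) z)) has_field_derivative
    PK_dlog k M b (unit_vec k a)) (at (M $$ (a, b)))"
proof -
  have upd: "update_mat M (a, b) (M $$ (a, b)) = M"
    by (auto intro!: eq_matI simp: update_mat_def)
  let ?u = "unit_vec k a" and ?z = "M $$ (a, b)"
  have summand: "((\<lambda>z. l i (minor_num k i (update_mat M (a, b) z) /
        minor_den k i (update_mat M (a, b) z))) has_field_derivative
      dlog_pluecker M [i..<i + k] b ?u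
       - dlog_pluecker M ([i..<i + k - 1] @ [i + k]) b ?u) (at ?z)"
    if i: "i < n" for i
  proof -
    let ?N = "\<lambda>z. minor_num k i (update_mat M (a, b) z)"
    let ?D = "\<lambda>z. minor_den k i (update_mat M (a, b) z)"
    let ?N' = "pluecker_dir M [i..<i + k] b ?u"
    let ?D' = "pluecker_dir M ([i..<i + k - 1] @ [i + k]) b ?u"
    have nz': "?N ?z \<noteq> 0" "?D ?z \<noteq> 0"
      using nz i unfolding PK_minors_nonzero_def upd by auto
    have inj: "inj_on (\<lambda>j. j mod n) {i..i + k}"
      by (rule inj_on_mod_window[OF k(2)])
    have "(?N has_field_derivative ?N') (at ?z)"
      unfolding minor_num_def using inj
      by (intro pluecker_has_field_derivative[OF M ab])
         (auto simp: distinct_map elim: inj_on_subset)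
    moreover have "(?D has_field_derivative ?D') (at ?z)"
      unfolding minor_den_def
    proof (intro pluecker_has_field_derivative[OF M ab])
      show "length ([i..<i + k - 1] @ [i + k]) = k" using k by simp
      have "inj_on (\<lambda>j. j mod n) (set ([i..<i + k - 1] @ [i + k]))"
        by (rule inj_on_subset[OF inj]) auto
      moreover have "distinct ([i..<i + k - 1] @ [i + k])" by auto
      ultimately show "distinct (map (\<lambda>j. j mod n) ([i..<i + k - 1] @ [i + k]))"
        by (simp only: distinct_map simp_thms)
    qed
    ultimately have quot: "((\<lambda>z. ?N z / ?D z) has_field_derivative
        (?N' * ?D ?z - ?N ?z * ?D') / (?D ?z * ?D ?z)) (at ?z)"
      using nz' by (intro DERIV_divide)
    have "(l i has_field_derivative inverse (?N ?z / ?D ?z)) (at (?N ?z / ?D ?z))"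
      using l[OF i] nz' unfolding upd by (intro log_branch_has_field_derivative) auto
    from DERIV_chain2[OF this quot]
    have "((\<lambda>z. l i (?N z / ?D z)) has_field_derivative
        inverse (?N ?z / ?D ?z) * ((?N' * ?D ?z - ?N ?z * ?D') / (?D ?z * ?D ?z))) (at ?z)" .
    moreover have "inverse (?N ?z / ?D ?z) * ((?N' * ?D ?z - ?N ?z * ?D') / (?D ?z * ?D ?z))
        = ?N' / ?N ?z - ?D' / ?D ?z"
      using nz' by (simp add: field_simps)
    ultimately show ?thesis
      by (simp only: dlog_pluecker_def upd minor_num_def minor_den_def)
  qed
  show ?thesis
    unfolding PK_potential_def PK_dlog_def
    using M summand by (auto intro!: DERIV_sum)
qed

section \<open>Matrices whose cyclic shift is equivalent to them\<close>

text \<open>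
  The matrix form of a fixed point of the cyclic action. The scalars \<open>d\<close> are indexed by all natural
  numbers and periodic, so that column indices can grow without being reduced modulo \<open>n\<close>.
\<close>

locale shift_invariant_matrix =
  fixes k n :: nat and M A :: "complex mat" and d :: "nat \<Rightarrow> complex"
  assumes k_pos: "0 < k" and k_less: "k < n"
    and M: "M \<in> carrier_mat k n" and A: "A \<in> carrier_mat k k"
    and det_A: "Determinant.det A \<noteq> 0"
    and d_nz: "d j \<noteq> 0" and d_mod: "d (j mod n) = d j"
    and shift_col: "cyc_col M (Suc j) = d j \<cdot>\<^sub>v (A *\<^sub>v cyc_col M j)"
    and minors_nz: "PK_minors_nonzero k n M"
begin

lemma n_pos: "0 < n" using k_less by simp

lemmas col_carrier [simp] = cyc_col_carrier[OF M]

text \<open>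
  The shifted minor, and likewise its derivative, arises from the original one by applying \<open>A\<close> to all
  columns and rescaling them. Both acquire the same factor, which cancels in the quotient; for the
  derivative this needs the direction to be rescaled by the factor that belongs to column \<open>b\<close>.
\<close>

lemma dlog_pluecker_shift:
  assumes len: "length js = k" and w: "w \<in> carrier_vec k"
  shows "dlog_pluecker M (map Suc js) (Suc b) (d b \<cdot>\<^sub>v (A *\<^sub>v w)) = dlog_pluecker M js b w"
proof -
  let ?c = "Determinant.det A * (\<Prod>r<k. d (js ! r))"
  have c: "?c \<noteq> 0" using det_A d_nz by simp
  have "pluecker M (map Suc js) = ?c * pluecker M js"
    using M len by (simp add: pluecker_cyc_col)
      (intro det_scaled_image_columns, auto simp: shift_col A)
  moreover have "pluecker_dir M (map Suc js) (Suc b) (d b \<cdot>\<^sub>v (A *\<^sub>v w))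
    = ?c * pluecker_dir M js b w"
  proof -
    have iff: "Suc x mod n = Suc y mod n \<longleftrightarrow> x mod n = y mod n" for x y
      by (auto simp: mod_Suc)
    have "Determinant.det (mat_of_cols k
          ((map (cyc_col M) (map Suc js))[r := d b \<cdot>\<^sub>v (A *\<^sub>v w)]))
        = ?c * Determinant.det (mat_of_cols k ((map (cyc_col M) js)[r := w]))"
      if r: "r < k" "js ! r mod n = b mod n" for r
    proof (intro det_scaled_image_columns A)
      have db: "d (js ! r) = d b" using r(2) d_mod by metis
      fix s assume s: "s < k"
      show "(map (cyc_col M) js)[r := w] ! s \<in> carrier_vec k"
        using s r len w by (cases "s = r") auto
      show "(map (cyc_col M) (map Suc js))[r := d b \<cdot>\<^sub>v (A *\<^sub>v w)] ! s
        = d (js ! s) \<cdot>\<^sub>v (A *\<^sub>v ((map (cyc_col M) js)[r := w] ! s))"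
        using s r len db by (cases "s = r") (auto simp: shift_col)
    qed (use len in auto)
    then show ?thesis
      using M len unfolding pluecker_dir_def sum_distrib_left
      by (intro sum.cong) (auto simp: iff)
  qed
  ultimately show ?thesis
    using c by (simp add: dlog_pluecker_def)
qed

lemma dlog_pluecker_periodic:
  "dlog_pluecker M (map (\<lambda>j. j + n) js) b w = dlog_pluecker M js b w"
proof -
  have "map (cyc_col M) (map (\<lambda>j. j + n) js) = map (cyc_col M) js"
    using M by (auto simp: cyc_col_def)
  moreover from this have "pluecker_dir M (map (\<lambda>j. j + n) js) b w = pluecker_dir M js b w"
    using M unfolding pluecker_dir_def by (simp del: map_map cong: if_cong)
  ultimately show ?thesis
    by (simp only: dlog_pluecker_def pluecker_cyc_col)
qed

text \<open>
  The shift moves the summand of window \<open>i\<close> to that of window \<open>i + 1\<close>, and window \<open>n\<close> is window \<open>0\<close>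
  again.
\<close>

lemma PK_dlog_shift:
  assumes w: "w \<in> carrier_vec k"
  shows "PK_dlog k M (Suc b) (d b \<cdot>\<^sub>v (A *\<^sub>v w)) = PK_dlog k M b w"
proof -
  define F where "F i b w = dlog_pluecker M [i..<i + k] b w
     - dlog_pluecker M ([i..<i + k - 1] @ [i + k]) b w" for i b w
  have shift: "F (Suc i) (Suc b) (d b \<cdot>\<^sub>v (A *\<^sub>v w)) = F i b w" for i
  proof -
    have "[Suc i..<Suc i + k] = map Suc [i..<i + k]"
      by (simp add: map_Suc_upt)
    moreover have "[Suc i..<Suc i + k - 1] @ [Suc i + k] = map Suc ([i..<i + k - 1] @ [i + k])"
      using k_pos by (simp add: map_Suc_upt)
    moreover have "length [i..<i + k] = k" "length ([i..<i + k - 1] @ [i + k]) = k"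
      using k_pos by auto
    ultimately show ?thesis
      unfolding F_def using w by (simp only: dlog_pluecker_shift)
  qed
  have periodic: "F n b w = F 0 b w" for b w
  proof -
    have "[n..<n + k] = map (\<lambda>j. j + n) [0..<0 + k]"
      by (simp add: map_add_upt add.commute)
    moreover have "[n..<n + k - 1] @ [n + k] = map (\<lambda>j. j + n) ([0..<0 + k - 1] @ [0 + k])"
      using k_pos by (simp add: map_add_upt add.commute)
    ultimately show ?thesis
      unfolding F_def by (simp only: dlog_pluecker_periodic)
  qed
  let ?w = "d b \<cdot>\<^sub>v (A *\<^sub>v w)"
  have "PK_dlog k M (Suc b) ?w = (\<Sum>i<n. F i (Suc b) ?w)"
    using M by (simp add: PK_dlog_def F_def)
  also have "\<dots> = (\<Sum>i<n. F (Suc i) (Suc b) ?w)"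
    using sum.lessThan_Suc_shift[of "\<lambda>i. F i (Suc b) ?w" n]
      sum.lessThan_Suc[of "\<lambda>i. F i (Suc b) ?w" n] periodic by simp
  also have "\<dots> = PK_dlog k M b w"
    using M by (simp add: shift) (simp add: PK_dlog_def F_def)
  finally show ?thesis .
qed

lemma A_pow_carrier [simp]: "A ^\<^sub>m j \<in> carrier_mat k k"
  using A by (rule pow_carrier_mat)

lemma A_pow_commute: "A * A ^\<^sub>m j = A ^\<^sub>m j * A"
proof (induction j)
  case (Suc j)
  have "A * (A ^\<^sub>m j * A) = (A * A ^\<^sub>m j) * A"
    using A by (simp add: assoc_mult_mat[of _ k k _ k _ k])
  then show ?case using Suc by simp
qed (use A in simp)

text \<open>
  Here the two symmetries meet: the numbers for different \<open>b\<close> agree by cyclic invariance and add up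
  to zero by invariance under left multiplication.
\<close>

lemma PK_dlog_pow_zero: "PK_dlog k M b (A ^\<^sub>m j *\<^sub>v cyc_col M b) = 0"
proof -
  define f where "f b = PK_dlog k M b (A ^\<^sub>m j *\<^sub>v cyc_col M b)" for b
  have step: "f (Suc b) = f b" for b
  proof -
    have "A ^\<^sub>m j *\<^sub>v cyc_col M (Suc b) = d b \<cdot>\<^sub>v ((A ^\<^sub>m j * A) *\<^sub>v cyc_col M b)"
      using A unfolding shift_col by (simp add: mult_mat_vec[of _ k k] del: assoc_mult_mat_vec)
         (simp add: assoc_mult_mat_vec[of _ k k _ k])
    also have "\<dots> = d b \<cdot>\<^sub>v (A *\<^sub>v (A ^\<^sub>m j *\<^sub>v cyc_col M b))"
      using A by (simp add: A_pow_commute[symmetric] assoc_mult_mat_vec[of _ k k _ k])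
    finally show ?thesis
      unfolding f_def by (simp add: PK_dlog_shift mult_mat_vec_carrier[of _ k k])
  qed
  then have const: "f b = f 0" for b by (induction b) auto
  have "(\<Sum>b<n. f b) = 0"
    unfolding f_def
    by (rule sum_PK_dlog_image[OF M k_pos n_pos minors_nz A_pow_carrier])
  then have "of_nat n * f 0 = 0" by (subst (asm) const) simp
  then have "f 0 = 0" using n_pos by simp
  then show ?thesis using const by (simp add: f_def)
qed

lemma cyc_col_add: "\<exists>c. cyc_col M (b + j) = c \<cdot>\<^sub>v (A ^\<^sub>m j *\<^sub>v cyc_col M b)"
proof (induction j)
  case 0
  show ?case using M A by (intro exI[of _ 1]) (simp add: one_mult_mat_vec[of _ k])
next
  case (Suc j)
  then obtain c where c: "cyc_col M (b + j) = c \<cdot>\<^sub>v (A ^\<^sub>m j *\<^sub>v cyc_col M b)" by blast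
  have v: "A ^\<^sub>m j *\<^sub>v cyc_col M b \<in> carrier_vec k"
    by (simp add: mult_mat_vec_carrier[of _ k k])
  have "cyc_col M (b + Suc j) = d (b + j) \<cdot>\<^sub>v (A *\<^sub>v cyc_col M (b + j))"
    using shift_col[of "b + j"] by simp
  also have "\<dots> = (d (b + j) * c) \<cdot>\<^sub>v (A *\<^sub>v (A ^\<^sub>m j *\<^sub>v cyc_col M b))"
    unfolding c using A v by (simp add: mult_mat_vec[OF A v] smult_smult_assoc)
  also have "A *\<^sub>v (A ^\<^sub>m j *\<^sub>v cyc_col M b) = A ^\<^sub>m Suc j *\<^sub>v cyc_col M b"
    using A by (simp add: A_pow_commute[symmetric] assoc_mult_mat_vec[of _ k k _ k])
  finally show ?case by blast
qed

lemma PK_dlog_column_zero: "PK_dlog k M b (cyc_col M (b + j)) = 0"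
proof -
  obtain c where c: "cyc_col M (b + j) = c \<cdot>\<^sub>v (A ^\<^sub>m j *\<^sub>v cyc_col M b)"
    using cyc_col_add by blast
  have v: "A ^\<^sub>m j *\<^sub>v cyc_col M b \<in> carrier_vec k"
    by (simp add: mult_mat_vec_carrier[of _ k k])
  have "PK_dlog k M b (c \<cdot>\<^sub>v (A ^\<^sub>m j *\<^sub>v cyc_col M b))
    = c * PK_dlog k M b (A ^\<^sub>m j *\<^sub>v cyc_col M b)"
    using M k_pos v by (intro PK_dlog_smult) auto
  then show ?thesis using c PK_dlog_pow_zero by simp
qed

text \<open>
  The linear form \<open>PK_dlog k M b\<close> vanishes on the \<open>k\<close> columns starting at \<open>b\<close>. Since their minor is
  nonzero, the row vector of its values on unit vectors is annihilated by an invertible matrix.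
\<close>

lemma PK_dlog_zero:
  assumes b: "b < n" and a: "a < k"
  shows "PK_dlog k M b (unit_vec k a) = 0"
proof -
  let ?V = "mat_of_cols k (map (cyc_col M) [b..<b + k])"
  let ?g = "Matrix.vec k (\<lambda>a. PK_dlog k M b (unit_vec k a))"
  have V: "?V \<in> carrier_mat k k" by (simp add: mat_of_cols_def)
  have "Determinant.det ?V \<noteq> 0"
    using minors_nz b M unfolding PK_minors_nonzero_def minor_num_def pluecker_cyc_col by auto
  then have "Determinant.det (transpose_mat ?V) \<noteq> 0"
    using det_transpose[OF V] by simp
  moreover have "transpose_mat ?V *\<^sub>v ?g = 0\<^sub>v k"
  proof (rule eq_vecI)
    fix r assume "r < dim_vec (0\<^sub>v k :: complex vec)"
    then have r: "r < k" by simp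
    have "(transpose_mat ?V *\<^sub>v ?g) $ r
      = (\<Sum>a<k. cyc_col M (b + r) $ a * PK_dlog k M b (unit_vec k a))"
      using r V by (auto simp: scalar_prod_def lessThan_atLeast0 mat_of_cols_index
          intro!: sum.cong)
    also have "\<dots> = PK_dlog k M b (cyc_col M (b + r))"
      using M k_pos by (intro PK_dlog_linear[symmetric]) auto
    finally show "(transpose_mat ?V *\<^sub>v ?g) $ r = 0\<^sub>v k $ r"
      using r PK_dlog_column_zero by simp
  qed (use V in simp)
  ultimately have "?g = 0\<^sub>v k"
    using det_0_iff_vec_prod_zero[of "transpose_mat ?V" k] V
      vec_carrier[of k "\<lambda>a. PK_dlog k M b (unit_vec k a)"]
    by (metis transpose_carrier_mat)
  then have "?g $ a = 0\<^sub>v k $ a" by simp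
  then show ?thesis using a by simp
qed

lemma partials_vanish: "PK_partials_vanish k n M"
  unfolding PK_partials_vanish_def
proof (intro allI impI)
  fix l :: "nat \<Rightarrow> complex \<Rightarrow> complex" and a b :: nat
  assume "\<forall>i<n. log_branch_at (minor_num k i M / minor_den k i M) (l i)" "a < k" "b < n"
  then show "((\<lambda>z. PK_potential k n l (update_mat M (a, b) z)) has_field_derivative 0)
      (at (M $$ (a, b)))"
    using PK_potential_has_field_derivative[OF M k_pos k_less _ _ minors_nz, of a b l]
      PK_dlog_zero by simp
qed

end

section \<open>From classes to matrices\<close>

lemma config_rel_columns:
  assumes rel: "(M, N) \<in> config_rel k n" and n: "0 < n"
  obtains A d where "A \<in> carrier_mat k k" "Determinant.det A = 1"
    "\<And>j. d j \<noteq> 0" "\<And>j. d (j mod n) = d j"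
    "\<And>j. cyc_col N j = d j \<cdot>\<^sub>v (A *\<^sub>v cyc_col M j)"
proof -
  from rel obtain A D where M: "M \<in> carrier_mat k n" and N: "N \<in> carrier_mat k n"
    and A: "A \<in> carrier_mat k k" "Determinant.det A = 1"
    and D: "D \<in> carrier_mat n n" "diagonal_mat D" "invertible_mat D" and NAD: "N = A * M * D"
    unfolding config_rel_def config_mats_def by auto
  let ?d = "\<lambda>j. D $$ (j mod n, j mod n)"
  have D_eq: "D = mat_diag n (\<lambda>j. D $$ (j, j))"
    using D by (auto intro!: eq_matI simp: mat_diag_def diagonal_mat_def)
  have "?d j \<noteq> 0" for j
  proof
    assume z: "?d j = 0"
    obtain B where B: "D * B = 1\<^sub>m n" "B * D = 1\<^sub>m (dim_row B)"
      using D unfolding invertible_mat_def inverts_mat_def by auto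
    have Bc: "B \<in> carrier_mat n n"
      using arg_cong[OF B(1), of dim_col] arg_cong[OF B(2), of dim_col] D
      by (auto intro: carrier_matI)
    have "(mat_diag n (\<lambda>j. D $$ (j, j)) * B) $$ (j mod n, j mod n) = 1"
      using n by (simp add: D_eq[symmetric] B(1))
    then show False
      using z n by (subst (asm) mat_diag_mult_left[OF Bc]) simp
  qed
  moreover have "cyc_col N j = ?d j \<cdot>\<^sub>v (A *\<^sub>v cyc_col M j)" for j
  proof -
    have "N = Matrix.mat k n (\<lambda>(i, j). (A * M) $$ (i, j) * D $$ (j, j))"
      unfolding NAD by (subst D_eq, rule mat_diag_mult_right) (use A M in auto)
    then show ?thesis
      using A M n by (auto intro!: eq_vecI simp: cyc_col_def)
  qed
  ultimately show ?thesis
    using that[of A ?d] A n by simp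
qed

theorem theorem3p3:
  fixes k n :: nat and M :: "complex mat"
  assumes "2 \<le> k" and "k + 2 \<le> n"
    and "M \<in> config_mats k n"
    and "cyclic_fixed_point k n (config_class k n M)"
    and "\<forall>i<n. minor_num k i M \<noteq> 0 \<and> minor_den k i M \<noteq> 0"
  shows "PK_critical_point k n (config_class k n M)"
  unfolding PK_critical_point_def
proof (intro conjI ballI)
  let ?C = "config_class k n M"
  show "?C \<in> config_space k n"
    using assms(4) unfolding cyclic_fixed_point_def by blast
  fix N assume N: "N \<in> ?C"
  have k: "0 < k" "k < n" and n: "0 < n" using assms(1,2) by auto
  have M: "M \<in> carrier_mat k n" using assms(3) by (simp add: config_mats_def)
  have MN: "(M, N) \<in> config_rel k n"
    using N by (simp add: config_class_def)
  then have Nc: "N \<in> carrier_mat k n"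
    by (simp add: config_rel_def config_mats_def)
  obtain A d where A: "A \<in> carrier_mat k k" "Determinant.det A = 1"
    and d: "\<And>j. d j \<noteq> 0" "\<And>j. d (j mod n) = d j"
    and colN: "\<And>j. cyc_col N j = d j \<cdot>\<^sub>v (A *\<^sub>v cyc_col M j)"
    using config_rel_columns[OF MN n] by blast
  have "cyclic_shift N \<in> ?C"
    using N assms(4) unfolding cyclic_fixed_point_def by blast
  then have "(M, cyclic_shift N) \<in> config_rel k n"
    by (simp add: config_class_def)
  then obtain B e where B: "B \<in> carrier_mat k k" "Determinant.det B = 1"
    and e: "\<And>j. e j \<noteq> 0" "\<And>j. e (j mod n) = e j"
    and colS: "\<And>j. cyc_col (cyclic_shift N) j = e j \<cdot>\<^sub>v (B *\<^sub>v cyc_col M j)"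
    using config_rel_columns[OF _ n] by blast
  have shiftN: "cyc_col (cyclic_shift N) j = cyc_col N (Suc j)" for j
    using Nc n by (auto intro!: eq_vecI simp: cyclic_shift_def cyc_col_def mod_Suc_eq)
  have cM: "cyc_col M j \<in> carrier_vec k" for j by (rule cyc_col_carrier[OF M])
  have nzN: "PK_minors_nonzero k n N"
  proof -
    have "pluecker N js \<noteq> 0" if "pluecker M js \<noteq> 0" "length js = k" for js
    proof -
      have "pluecker N js = Determinant.det A * (\<Prod>r<k. d (js ! r)) * pluecker M js"
        unfolding pluecker_cyc_col using M Nc that(2)
        by (simp only: carrier_matD) (intro det_scaled_image_columns[OF _ _ _ A(1)],
          use cM colN Nc M in auto)
      then show ?thesis using that A d by simp
    qed
    then show ?thesis
      using assms(5) k unfolding PK_minors_nonzero_def minor_num_def minor_den_def by simp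
  qed
  \<comment> \<open>The representative \<open>N\<close> and its shift are both related to \<open>M\<close> itself, so eliminating \<open>M\<close> gives
    the relation between \<open>N\<close> and its shift.\<close>
  obtain A' where A': "A' \<in> carrier_mat k k" "A' * A = 1\<^sub>m k"
  proof
    show "adj_mat A \<in> carrier_mat k k" by (rule adj_mat(1)[OF A(1)])
    show "adj_mat A * A = 1\<^sub>m k"
      using adj_mat(3)[OF A(1)] A(2) by (auto intro!: eq_matI)
  qed
  have detA': "Determinant.det A' \<noteq> 0"
    using det_mult[OF A'(1) A(1)] A'(2) by auto
  interpret shift_invariant_matrix k n N "B * A'" "\<lambda>j. e j / d j"
  proof
    fix j
    have "A' *\<^sub>v cyc_col N j = d j \<cdot>\<^sub>v ((A' * A) *\<^sub>v cyc_col M j)"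
      unfolding colN using A(1) A'(1) cM
      by (simp add: mult_mat_vec[of _ k k] assoc_mult_mat_vec[of _ k k _ k])
    then have "A' *\<^sub>v cyc_col N j = d j \<cdot>\<^sub>v cyc_col M j"
      using A'(2) cM by simp
    then have "(B * A') *\<^sub>v cyc_col N j = d j \<cdot>\<^sub>v (B *\<^sub>v cyc_col M j)"
      using B A' cyc_col_carrier[OF Nc] cM
      by (simp add: assoc_mult_mat_vec[of _ k k _ k] mult_mat_vec[of _ k k])
    then show "cyc_col N (Suc j) = e j / d j \<cdot>\<^sub>v ((B * A') *\<^sub>v cyc_col N j)"
      using colS[of j] shiftN[of j] d(1)[of j] by (simp add: smult_smult_assoc)
  qed (use k Nc A' B detA' d e nzN in \<open>auto simp: det_mult[OF B(1) A'(1)]\<close>)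
  show "PK_minors_nonzero k n N" by (rule nzN)
  show "PK_partials_vanish k n N" by (rule partials_vanish)
qed

end
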